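(* Let $P$ be a polytope of states which is the convex hull of a finite set of pure states: $$P = \mathrm{conv}\{|\psi_1\rangle\langle\psi_1|, |\psi_2\rangle\langle\psi_2|, \ldots, |\psi_m\rangle\langle\psi_m|\} \subseteq \mathcal D(\mathcal H_{d,n}).$$ Then there exists $\varepsilon^*>0$ such that for any pure state $\Psi = |\psi\rangle\langle\psi| \in \mathcal D(\mathcal H_{d,n})$ with $$d_P(\Psi) = \min_{\sigma\in P} T(\Psi,\sigma) = \varepsilon \le \varepsilon^*,$$ there is a vertex $|\psi_j\rangle\langle\psi_j|$ of $P$ such that $$T(\Psi, |\psi_j\rangle\langle\psi_j|) \le \varepsilon + 2\sqrt{1-h^{-1}[f(\varepsilon, d^n)]}.$$
   Context: $\mathcal H_{d,n} = (\mathbb C^d)^{\otimes n}$ with $d$ prime and $n\ge 1$, and $\mathcal D(\mathcal H_{d,n})$ is the set of density operators (positive semidefinite, trace one) on it. A pure state is a rank-one projector $|\psi\rangle\langle\psi|$ with $|\psi\rangle$ a unit vector. The trace distance is $T(\rho,\sigma) = \frac12\|\rho-\sigma\|$, where $\|A\| = \mathrm{Tr}\sqrt{A^\dagger A}$ is the trace norm. All logarithms are base 2, with the convention $0\log 0 = 0$. The Fannes error is $$f(t,d^n) = t\log(d^n-1) + H[\{t,1-t\}],\qquad H[\{t,1-t\}] = -t\log t-(1-t)\log(1-t).$$ The binary entropy function is $h(x) = -x\log x-(1-x)\log(1-x)$. Its restriction to $[\frac12,1]$ is a strictly decreasing bijection onto $[0,1]$, and $h^{-1}:[0,1]\to[\frac12,1]$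 denotes the inverse of this restriction. The displayed bound is understood to include that its right-hand side is well defined, i.e. $f(\varepsilon,d^n)\in[0,1]$ for the $\varepsilon$ considered. *)

theory Defs
  imports "HOL-Analysis.Analysis" "HOL-Computational_Algebra.Primes"
begin

text \<open>The space \<open>(\<complex>\<^sup>d)\<^sup>\<otimes>\<^sup>n\<close> is represented in its computational product basis: a basis vector
  \<open>|x\<^sub>1\<rangle> \<otimes> \<dots> \<otimes> |x\<^sub>n\<rangle>\<close> is indexed by the function sending site \<open>k :: 'n\<close> to \<open>x\<^sub>k :: 'd\<close>, so
  that \<open>d = CARD('d)\<close>, \<open>n = CARD('n) \<ge> 1\<close>, and there are \<open>d\<^sup>n\<close> basis vectors. The norm of
  this vector type is the Hilbert space norm.\<close>

type_synonym ('d, 'n) hspace = "complex ^ ('n \<Rightarrow> 'd)"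
type_synonym ('d, 'n) hop = "complex ^ ('n \<Rightarrow> 'd) ^ ('n \<Rightarrow> 'd)"

definition braket :: "complex ^ 'i \<Rightarrow> complex ^ 'i \<Rightarrow> complex"
  where "braket u v = (\<Sum>i\<in>UNIV. cnj (u $ i) * v $ i)"

definition dagger :: "complex ^ 'i ^ 'i \<Rightarrow> complex ^ 'i ^ 'i"
  where "dagger A = (\<chi> i j. cnj (A $ j $ i))"

definition psd :: "complex ^ 'i ^ 'i \<Rightarrow> bool"
  where "psd A \<longleftrightarrow> dagger A = A \<and> (\<forall>v. 0 \<le> Re (braket v (A *v v)))"

definition density_operators :: "(complex ^ 'i ^ 'i) set"
  where "density_operators = {A. psd A \<and> trace A = 1}"

definition ket_bra :: "complex ^ 'i \<Rightarrow> complex ^ 'i ^ 'i"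
  where "ket_bra u = (\<chi> i j. u $ i * cnj (u $ j))"

text \<open>Every positive semidefinite matrix has exactly one positive semidefinite square root.\<close>

definition psd_sqrt :: "complex ^ 'i ^ 'i \<Rightarrow> complex ^ 'i ^ 'i"
  where "psd_sqrt A = (THE B. psd B \<and> B ** B = A)"

text \<open>The trace below is real, being that of a positive semidefinite matrix.\<close>

definition trace_norm :: "complex ^ 'i ^ 'i \<Rightarrow> real"
  where "trace_norm A = Re (trace (psd_sqrt (dagger A ** A)))"

definition trace_distance :: "complex ^ 'i ^ 'i \<Rightarrow> complex ^ 'i ^ 'i \<Rightarrow> real"
  where "trace_distance \<rho> \<sigma> = trace_norm (\<rho> - \<sigma>) / 2"

text \<open>For a nonempty compact set, such as the convex hull of finitely many states, the infimum
  is attained and hence is a minimum.\<close>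

definition distance_to :: "(complex ^ 'i ^ 'i) set \<Rightarrow> complex ^ 'i ^ 'i \<Rightarrow> real"
  where "distance_to P \<rho> = (INF \<sigma>\<in>P. trace_distance \<rho> \<sigma>)"

text \<open>The convention \<open>0 log 0 = 0\<close> holds automatically because \<^term>\<open>log 2 0\<close> is a real number.\<close>

definition binary_entropy :: "real \<Rightarrow> real"
  where "binary_entropy x = - x * log 2 x - (1 - x) * log 2 (1 - x)"

definition binary_entropy_inv :: "real \<Rightarrow> real"
  where "binary_entropy_inv = the_inv_into {1/2..1} binary_entropy"

definition fannes :: "real \<Rightarrow> nat \<Rightarrow> real"
  where "fannes t D = t * log 2 (real D - 1) + binary_entropy t"

lemma ket_bra_density:
  assumes "norm u = 1"
  shows "ket_bra u \<in> density_operators"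
proof -
  have d: "dagger (ket_bra u) = ket_bra u"
    by (simp add: dagger_def ket_bra_def vec_eq_iff mult.commute)
  have "braket v (ket_bra u *v v) = braket v u * cnj (braket v u)" for v
    by (simp add: braket_def ket_bra_def matrix_vector_mult_def sum_product sum_distrib_left
        mult_ac) (rule sum.swap)
  then have p: "0 \<le> Re (braket v (ket_bra u *v v))" for v
    by (simp add: complex_mult_cnj)
  have "trace (ket_bra u) = of_real (\<Sum>i\<in>UNIV. (norm (u $ i))\<^sup>2)"
    by (simp add: trace_def ket_bra_def complex_norm_square del: of_real_power)
  also have "(\<Sum>i\<in>UNIV. (norm (u $ i))\<^sup>2) = 1"
    using assms by (simp add: norm_vec_def L2_set_def)
  finally show ?thesis using d p by (simp add: density_operators_def psd_def)
qed

lemma convex_density_operators: "convex density_operators"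
proof (rule convexI)
  fix A B :: "complex ^ 'i ^ 'i" and s t :: real
  assume A: "A \<in> density_operators" and B: "B \<in> density_operators"
    and st: "0 \<le> s" "0 \<le> t" "s + t = 1"
  let ?C = "s *\<^sub>R A + t *\<^sub>R B"
  have "dagger ?C = s *\<^sub>R dagger A + t *\<^sub>R dagger B"
    by (simp add: dagger_def vec_eq_iff)
  moreover have "braket v (?C *v v) = s *\<^sub>R braket v (A *v v) + t *\<^sub>R braket v (B *v v)" for v
  proof -
    have "?C *v v = s *\<^sub>R (A *v v) + t *\<^sub>R (B *v v)"
      by (simp add: matrix_vector_mult_def vec_eq_iff scaleR_sum_right distrib_right sum.distrib)
    then show ?thesis
      by (simp add: braket_def scaleR_sum_right distrib_left sum.distrib)
  qed
  moreover have "trace ?C = s *\<^sub>R trace A + t *\<^sub>R trace B"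
    by (simp add: trace_def sum.distrib scaleR_sum_right)
  moreover have "s *\<^sub>R 1 + t *\<^sub>R (1::complex) = 1"
    using st(3) by (metis scaleR_left_distrib scaleR_one)
  ultimately show "?C \<in> density_operators"
    using A B st by (simp add: density_operators_def psd_def)
qed

lemma convex_hull_ket_bra_subset:
  assumes "\<And>u. u \<in> U \<Longrightarrow> norm u = 1"
  shows "convex hull (ket_bra ` U) \<subseteq> density_operators"
  using assms ket_bra_density convex_density_operators by (intro hull_minimal) auto

end

(* If sigma = sum_j p_j |psi_j><psi_j| lies in P, then testing Psi - sigma against the
   reflection 2 Psi - 1 gives 1 - <psi|sigma|psi> <= T(Psi, sigma). The overlap is affine in sigma, so
   some vertex satisfies 1 - |<psi|psi_j>|^2 <= eps, that is, T(Psi, psi_j) <= sqrt eps. No entropy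
   estimate for states is needed: f(eps) >= h(eps) = h(1 - eps) already gives
   1 - h^{-1}(f(eps)) >= eps, provided that eps <= 1/2 and f(eps) <= 1; this fixes eps*.
   Every |psi_j><psi_j| is a vertex because it has Frobenius norm 1 and P lies in the unit ball. *)

theory Submission
  imports Defs "HOL-Real_Asymp.Real_Asymp"
begin

section \<open>Matrix algebra\<close>

lemma matrix_diff_ldistrib: "A ** (B - C) = A ** B - A ** (C :: 'a::ring_1 ^ 'n ^ 'm)"
  by (simp add: matrix_matrix_mult_def vec_eq_iff right_diff_distrib sum_subtractf)

lemma matrix_diff_rdistrib: "(B - C) ** A = B ** A - (C :: 'a::ring_1 ^ 'n ^ 'm) ** A"
  by (simp add: matrix_matrix_mult_def vec_eq_iff left_diff_distrib sum_subtractf)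

lemma matrix_add_rdistrib: "(B + C) ** A = B ** A + (C :: 'a::semiring_1 ^ 'n ^ 'm) ** A"
  by (simp add: matrix_matrix_mult_def vec_eq_iff distrib_right sum.distrib)

lemma trace_scaleR: "trace (c *\<^sub>R A) = c *\<^sub>R trace (A :: complex ^ 'i ^ 'i)"
  by (simp add: trace_def scaleR_sum_right)

lemma trace_uminus_mult: "trace (- A ** B) = - trace (A ** (B :: complex ^ 'i ^ 'i))"
  by (simp add: trace_def matrix_matrix_mult_def sum_negf)

lemma braket_add_left: "braket (u + v) w = braket u w + braket v w"
  and braket_add_right: "braket w (u + v) = braket w u + braket w v"
  and braket_diff_right: "braket w (u - v) = braket w u - braket w v"
  by (simp_all add: braket_def algebra_simps sum.distrib sum_subtractf)

lemma braket_smult_left: "braket (c *s u) w = cnj c * braket u w"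
  and braket_smult_right: "braket w (c *s u) = c * braket w u"
  by (simp_all add: braket_def sum_distrib_left mult_ac)

lemma cnj_braket: "cnj (braket u v) = braket v u"
  by (simp add: braket_def mult.commute)

lemma braket_self: "braket v v = of_real ((norm v)\<^sup>2)"
proof -
  have "braket v v = of_real (\<Sum>i\<in>UNIV. (norm (v $ i))\<^sup>2)"
    by (simp add: braket_def complex_norm_square mult.commute del: of_real_power)
  then show ?thesis
    by (simp add: norm_vec_def L2_set_def sum_nonneg)
qed

lemma braket_matrix_left: "braket (A *v u) v = braket u (dagger A *v v)"
  by (simp add: braket_def dagger_def matrix_vector_mult_def sum_distrib_left sum_distrib_right
      mult_ac) (rule sum.swap)

lemma matrix_vector_mult_axis: "(A *v axis j 1) $ i = (A :: complex ^ 'n ^ 'm) $ i $ j"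
  by (simp add: matrix_vector_mult_def axis_def if_distrib if_distribR cong: if_cong)

lemma braket_axis: "braket (axis i 1) (A *v axis j 1) = A $ i $ j"
proof -
  have "braket (axis i 1) w = w $ i" for w :: "complex ^ 'a"
    by (simp add: braket_def axis_def if_distrib if_distribR cong: if_cong)
  then show ?thesis
    by (simp add: matrix_vector_mult_axis)
qed

lemma dagger_dagger [simp]: "dagger (dagger A) = A"
  by (simp add: dagger_def vec_eq_iff)

lemma dagger_add: "dagger (A + B) = dagger A + dagger B"
  and dagger_diff: "dagger (A - B) = dagger A - dagger B"
  and dagger_scaleR: "dagger (c *\<^sub>R A) = c *\<^sub>R dagger A"
  by (simp_all add: dagger_def vec_eq_iff)

lemma dagger_mult: "dagger (A ** B) = dagger B ** dagger A"
  by (simp add: dagger_def matrix_matrix_mult_def vec_eq_iff mult.commute)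

lemma dagger_mat_1 [simp]: "dagger (mat 1) = mat 1"
  by (simp add: dagger_def mat_def vec_eq_iff)

lemma trace_dagger_mult_self: "trace (dagger A ** A) = of_real ((norm A)\<^sup>2)"
proof -
  have "trace (dagger A ** A) = of_real (\<Sum>i\<in>UNIV. \<Sum>k\<in>UNIV. (norm (A $ k $ i))\<^sup>2)"
    by (simp add: trace_def matrix_matrix_mult_def dagger_def complex_norm_square mult.commute
        del: of_real_power)
  also have "(\<Sum>i\<in>UNIV. \<Sum>k\<in>UNIV. (norm (A $ k $ i))\<^sup>2) =
      (\<Sum>k\<in>UNIV. \<Sum>i\<in>UNIV. (norm (A $ k $ i))\<^sup>2)"
    by (rule sum.swap)
  finally show ?thesis
    by (simp add: norm_vec_def L2_set_def sum_nonneg)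
qed

text \<open>The operator |u><v|. Allowing two different vectors gives a class of rank-one operators
  closed under products and \<open>dagger\<close>, unlike the projectors
  \<open>ket_bra u\<close>.\<close>

definition outer :: "complex ^ 'i \<Rightarrow> complex ^ 'i \<Rightarrow> complex ^ 'i ^ 'i"
  where "outer u v = (\<chi> i j. u $ i * cnj (v $ j))"

lemma ket_bra_eq_outer: "ket_bra u = outer u u"
  by (simp add: ket_bra_def outer_def)

lemma dagger_outer: "dagger (outer u v) = outer v u"
  by (simp add: dagger_def outer_def vec_eq_iff mult.commute)

lemma outer_mult: "outer a b ** outer c d = outer (braket b c *s a) d"
  by (simp add: outer_def braket_def matrix_matrix_mult_def vec_eq_iff sum_distrib_left
      sum_distrib_right mult_ac)

lemma outer_mult_vector: "outer a b *v x = braket b x *s a"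
  by (simp add: outer_def braket_def matrix_vector_mult_def vec_eq_iff sum_distrib_left mult_ac)

lemma trace_outer_mult: "trace (outer a b ** A) = braket b (A *v a)"
  by (simp add: trace_def outer_def braket_def matrix_matrix_mult_def matrix_vector_mult_def
      sum_distrib_left mult_ac) (rule sum.swap)

section \<open>Positive semidefinite matrices and their square roots\<close>

lemma psd_dagger_mult_self: "psd (dagger A ** A)"
  unfolding psd_def
proof (intro conjI allI)
  fix v
  have "braket v ((dagger A ** A) *v v) = braket (A *v v) (A *v v)"
    by (simp add: braket_matrix_left matrix_vector_mul_assoc)
  then show "0 \<le> Re (braket v ((dagger A ** A) *v v))"
    by (simp add: braket_self)
qed (simp add: dagger_mult)

lemma psd_scaleR:
  assumes "psd A" "0 \<le> c"
  shows "psd (c *\<^sub>R A)"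
proof -
  have "braket v ((c *\<^sub>R A) *v v) = c *\<^sub>R braket v (A *v v)" for v
    by (simp add: braket_def matrix_vector_mult_def sum_distrib_left scaleR_sum_right)
  then show ?thesis
    using assms by (simp add: psd_def dagger_scaleR)
qed

text \<open>Polarization: reality of the form at \<open>u + v\<close> matches the imaginary parts of
  <u|A|v> and the conjugate of <v|A|u>, and reality at \<open>u + \<i> *s v\<close> matches the real
  parts. Basis vectors then give the entries.\<close>

lemma dagger_eq_self_if_quadratic_form_real:
  assumes real: "\<And>v. Im (braket v (A *v v)) = 0"
  shows "dagger A = A"
proof -
  have *: "braket u (A *v v) = cnj (braket v (A *v u))" for u v
  proof -
    have "Im (braket u (A *v v)) + Im (braket v (A *v u)) = 0"
      using real[of "u + v"] real[of u] real[of v]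
      by (simp add: matrix_vector_right_distrib braket_add_left braket_add_right)
    moreover have "Re (braket u (A *v v)) - Re (braket v (A *v u)) = 0"
      using real[of "u + \<i> *s v"] real[of u] real[of v]
      by (simp add: matrix_vector_right_distrib braket_add_left braket_add_right
          braket_smult_left braket_smult_right vector_scalar_commute)
    ultimately show ?thesis
      by (simp add: complex_eq_iff)
  qed
  have "cnj (A $ j $ i) = A $ i $ j" for i j
    using *[of "axis i 1" "axis j 1"] unfolding braket_axis by (rule sym)
  then show ?thesis
    by (simp only: dagger_def vec_eq_iff vec_lambda_beta simp_thms)
qed

text \<open>Moving from \<open>w\<close> to \<open>w + t z\<close> with \<open>z = B *v w\<close>
  changes the form by \<open>2 * t * N + t\<^sup>2 * q\<close>. If \<open>N > 0\<close>, the linear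
  term makes this negative for a small negative \<open>t\<close>.\<close>

lemma psd_kernel:
  assumes "psd B" "Re (braket w (B *v w)) = 0"
  shows "B *v w = 0"
proof (rule ccontr)
  define z where "z = B *v w"
  define q where "q = Re (braket z (B *v z))"
  define N where "N = (norm z)\<^sup>2"
  assume "B *v w \<noteq> 0"
  then have N: "N > 0"
    by (simp add: N_def z_def)
  have herm: "dagger B = B"
    using assms by (simp add: psd_def)
  have wz: "braket w (B *v z) = of_real N" "braket z (B *v w) = of_real N"
    using braket_matrix_left[of B w z] by (simp_all add: herm z_def[symmetric] braket_self N_def)
  have ineq: "0 \<le> 2 * t * N + t\<^sup>2 * q" for t :: real
  proof -
    have "0 \<le> Re (braket (w + of_real t *s z) (B *v (w + of_real t *s z)))"
      using assms by (simp add: psd_def)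
    also have "\<dots> = 2 * t * N + t\<^sup>2 * q"
      using assms(2)
      by (simp add: matrix_vector_right_distrib braket_add_left braket_add_right
          braket_smult_left braket_smult_right vector_scalar_commute wz q_def
          power2_eq_square algebra_simps)
    finally show ?thesis .
  qed
  have "q \<ge> 0"
    using assms by (simp add: psd_def q_def)
  \<comment> \<open>The minimizer would be \<open>- N / q\<close>; the shift by 1 covers
    \<open>q = 0\<close> and keeps the value negative.\<close>
  define t where "t = - N / (q + 1)"
  have "t < 0"
    using \<open>q \<ge> 0\<close> N by (simp add: t_def)
  have "t * q = - (N * (q / (q + 1)))"
    by (simp add: t_def)
  moreover have "N * (q / (q + 1)) \<le> N * 1"
    using \<open>q \<ge> 0\<close> N by (intro mult_left_mono) auto
  ultimately have "2 * N + t * q > 0"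
    using N by linarith
  then have "t * (2 * N + t * q) < 0"
    using \<open>t < 0\<close> by (rule mult_neg_pos[rotated])
  then show False
    using ineq[of t] by (simp add: power2_eq_square algebra_simps)
qed

text \<open>With \<open>X = B - C\<close>, the identity \<open>X (B + C) + (B + C) X = 2 (B\<^sup>2 - C\<^sup>2) = 0\<close> multiplied by
  \<open>X\<close> gives \<open>tr (X B X) + tr (X C X) = 0\<close>, so that \<open>B\<close> and \<open>C\<close> both vanish on the range of \<open>X\<close>.\<close>

lemma psd_sqrt_unique:
  assumes B: "psd B" and C: "psd C" and eq: "B ** B = C ** C"
  shows "B = C"
proof -
  define X where "X = B - C"
  have hX: "dagger X = X"
    using B C by (simp add: X_def psd_def dagger_diff)
  have "X ** (B + C) + (B + C) ** X = 0"
    by (simp add: X_def matrix_diff_ldistrib matrix_diff_rdistrib matrix_add_ldistrib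
        matrix_add_rdistrib eq)
  then have "trace (X ** (X ** (B + C) + (B + C) ** X)) = 0"
    by (simp add: trace_0[simplified])
  moreover have "trace (X ** (X ** (B + C))) = trace (X ** (B + C) ** X)"
    by (metis trace_mul_sym)
  ultimately have "trace (X ** (B + C) ** X) = 0"
    by (simp add: matrix_add_ldistrib[of X "X ** (B + C)"] trace_add matrix_mul_assoc)
  \<comment> \<open>As \<open>X\<close> is Hermitian, each diagonal entry is the form of
    \<open>B + C\<close> at a column of \<open>X\<close>. A vanishing sum of nonnegative terms then
    forces every term to vanish.\<close>
  moreover have "trace (X ** (B + C) ** X) =
      (\<Sum>i\<in>UNIV. braket (X *v axis i 1) (B *v (X *v axis i 1))
        + braket (X *v axis i 1) (C *v (X *v axis i 1)))"
    unfolding trace_def braket_axis[symmetric] matrix_vector_mul_assoc[symmetric]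
    using hX by (simp add: braket_matrix_left braket_add_right matrix_vector_mult_add_rdistrib
        matrix_vector_right_distrib)
  ultimately have sum0: "(\<Sum>i\<in>UNIV. Re (braket (X *v axis i 1) (B *v (X *v axis i 1)))
        + Re (braket (X *v axis i 1) (C *v (X *v axis i 1)))) = 0"
    by (metis (no_types, lifting) Re_sum plus_complex.sel(1) sum.cong zero_complex.sel(1))
  have nonneg: "0 \<le> Re (braket v (B *v v))" "0 \<le> Re (braket v (C *v v))" for v
    using B C by (simp_all add: psd_def)
  have "X *v (X *v axis i 1) = 0" for i
  proof -
    have "Re (braket (X *v axis i 1) (B *v (X *v axis i 1)))
        + Re (braket (X *v axis i 1) (C *v (X *v axis i 1))) = 0"
      using sum0 nonneg by (subst (asm) sum_nonneg_eq_0_iff) (auto simp: add_nonneg_nonneg)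
    then have "B *v (X *v axis i 1) = 0" "C *v (X *v axis i 1) = 0"
      using nonneg psd_kernel[OF B] psd_kernel[OF C] by (smt (verit))+
    then show ?thesis
      by (simp add: X_def matrix_vector_mult_diff_rdistrib)
  qed
  then have "(norm (X *v axis i 1))\<^sup>2 = 0" for i
    using braket_self[of "X *v axis i 1"] braket_matrix_left[of X "axis i 1" "X *v axis i 1"]
    by (simp add: hX braket_def)
  then have "X = 0"
    by (simp add: vec_eq_iff flip: matrix_vector_mult_axis)
  then show ?thesis
    by (simp add: X_def)
qed

text \<open>Uniqueness of the root resolves the definite description in \<open>psd_sqrt\<close>, so
  the trace norm can be computed from any exhibited root.\<close>

lemma trace_norm_eqI:
  assumes "psd B" "B ** B = dagger A ** A"
  shows "trace_norm A = Re (trace B)"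
proof -
  have "psd_sqrt (dagger A ** A) = B"
    unfolding psd_sqrt_def using assms by (intro the_equality) (auto intro: psd_sqrt_unique)
  then show ?thesis
    by (simp add: trace_norm_def)
qed

section \<open>Unitary matrices and the variational formula for the trace norm\<close>

definition unitary :: "complex ^ 'i ^ 'i \<Rightarrow> bool"
  where "unitary U \<longleftrightarrow> dagger U ** U = mat 1"

lemma unitary_mat_1: "unitary (mat 1)"
  by (simp add: unitary_def)

lemma unitary_mult:
  assumes "unitary U" "unitary V"
  shows "unitary (U ** V)"
  using assms unfolding unitary_def
  by (metis dagger_mult matrix_mul_assoc matrix_mul_lid)

lemma unitary_uminus: "unitary U \<Longrightarrow> unitary (- U)"
  by (simp add: unitary_def dagger_def matrix_matrix_mult_def)

text \<open>This matrix multiplies \<open>w\<close> by the phase \<open>e\<close> and fixes the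
  orthogonal complement of \<open>w\<close>. Its unitarity reduces to |e - 1|^2 + 2 Re (e - 1) =
  |e|^2 - 1 = 0.\<close>

lemma unitary_phase:
  assumes "norm w = 1" "norm e = 1"
  shows "unitary (mat 1 + outer ((e - 1) *s w) w)"
proof -
  let ?a = "(e - 1) *s w"
  have "cnj e * e = 1"
    using assms(2) complex_norm_square[of e] by (simp add: mult.commute)
  then have *: "(cnj (e - 1) * (e - 1)) + (e - 1) + cnj (e - 1) = 0"
    by (simp add: algebra_simps)
  have a: "braket ?a ?a = cnj (e - 1) * (e - 1)"
    unfolding braket_smult_left braket_smult_right using assms(1) by (simp add: braket_self)
  have "outer w ?a + outer ?a w + outer (braket ?a ?a *s w) w =
      outer (((cnj (e - 1) * (e - 1)) + (e - 1) + cnj (e - 1)) *s w) w"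
    unfolding a by (simp add: outer_def vec_eq_iff algebra_simps)
  also have "\<dots> = 0"
    unfolding * by (simp add: outer_def vec_eq_iff)
  finally show ?thesis
    by (simp add: unitary_def dagger_add dagger_outer matrix_add_ldistrib matrix_add_rdistrib
        outer_mult algebra_simps)
qed

lemma trace_phase_mult:
  "trace ((mat 1 + outer ((e - 1) *s w) w) ** A) = trace A + (e - 1) * braket w (A *v w)"
  unfolding matrix_add_rdistrib matrix_mul_lid trace_add trace_outer_mult vector_scalar_commute
    braket_smult_right ..

text \<open>The Frobenius norm is constant on unitaries, its square being the trace of the identity,
  and the defining equation is closed.\<close>

lemma compact_unitary: "compact {U :: complex ^ 'i ^ 'i. unitary U}"
proof -
  have "norm U = sqrt (Re (trace (mat 1 :: complex ^ 'i ^ 'i)))"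
    if "unitary U" for U :: "complex ^ 'i ^ 'i"
    using that trace_dagger_mult_self[of U] by (simp add: unitary_def)
  then have "bounded {U :: complex ^ 'i ^ 'i. unitary U}"
    unfolding bounded_iff by (metis mem_Collect_eq order_refl)
  moreover have "closed {U :: complex ^ 'i ^ 'i. unitary U}"
    unfolding unitary_def dagger_def matrix_matrix_mult_def
    by (intro closed_Collect_eq continuous_intros)
  ultimately show ?thesis
    by (simp add: compact_eq_bounded_closed)
qed

text \<open>A unitary \<open>U\<close> maximising \<open>Re (tr (U A))\<close> exists by compactness. Comparing it with
  \<open>(1 + (e - 1) |w\<rangle>\<langle>w|) U\<close> for all phases \<open>e\<close> shows that \<open>\<langle>w|U A|w\<rangle>\<close> is a nonnegative real number,
  so \<open>U A\<close> is the square root of \<open>A\<^sup>\<dagger> A\<close>.\<close>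

lemma polar_decomposition:
  fixes A :: "complex ^ 'i ^ 'i"
  obtains U where "unitary U" "psd (U ** A)"
    "\<And>V. unitary V \<Longrightarrow> Re (trace (V ** A)) \<le> Re (trace (U ** A))"
proof -
  have "continuous_on {U :: complex ^ 'i ^ 'i. unitary U} (\<lambda>U. Re (trace (U ** A)))"
    unfolding trace_def matrix_matrix_mult_def by (auto intro!: continuous_intros)
  then obtain U where U: "unitary U"
    and max: "\<And>V. unitary V \<Longrightarrow> Re (trace (V ** A)) \<le> Re (trace (U ** A))"
    using continuous_attains_sup[OF compact_unitary] unitary_mat_1 by blast
  let ?N = "U ** A"
  have unit: "braket w (?N *v w) = of_real (cmod (braket w (?N *v w)))" if w: "norm w = 1" for w
  proof -
    define z where "z = braket w (?N *v w)"
    have le: "Re (e * z) \<le> Re z" if "norm e = 1" for e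
    proof -
      let ?V = "mat 1 + outer ((e - 1) *s w) w"
      have eq: "trace (?V ** U ** A) = trace ?N + (e - 1) * z"
        unfolding z_def matrix_mul_assoc[symmetric] by (rule trace_phase_mult)
      then show ?thesis
        using max[OF unitary_mult[OF unitary_phase[OF w that] U]] unfolding eq
        by (simp add: left_diff_distrib)
    qed
    have "cmod z \<le> Re z"
    proof (cases "z = 0")
      case False
      \<comment> \<open>This phase rotates \<open>z\<close> onto the positive real axis, so
        maximality yields \<open>cmod z \<le> Re z\<close>.\<close>
      then have "cnj z / of_real (cmod z) * z = of_real (cmod z)"
        using complex_norm_square[of z] by (simp add: field_simps power2_eq_square)
      then show ?thesis
        using le[of "cnj z / of_real (cmod z)"] False by (simp add: norm_divide)
    qed simp
    then have "Re z = cmod z"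
      using complex_Re_le_cmod[of z] by linarith
    then show ?thesis
      using cmod_power2[of z] by (simp add: z_def[symmetric] complex_eq_iff)
  qed
  have form: "Re (braket v (?N *v v)) \<ge> 0 \<and> Im (braket v (?N *v v)) = 0" for v
  proof (cases "v = 0")
    case False
    define w where "w = of_real (inverse (norm v)) *s v"
    have v: "v = of_real (norm v) *s w"
      using False by (simp add: w_def vector_smult_assoc)
    have "norm w = 1"
    proof -
      have "w = inverse (norm v) *\<^sub>R v"
        by (simp add: w_def vec_eq_iff scaleR_conv_of_real[where 'a = complex])
      then show ?thesis
        using False by simp
    qed
    note unit[OF this]
    moreover have "braket v (?N *v v) = of_real ((norm v)\<^sup>2) * braket w (?N *v w)"
      by (subst (1 2) v) (simp only: vector_scalar_commute braket_smult_left braket_smult_right,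
        simp add: power2_eq_square)
    ultimately show ?thesis
      by (metis Im_complex_of_real Re_complex_of_real mult_nonneg_nonneg norm_ge_zero of_real_mult
          zero_le_power2)
  qed (simp add: braket_def)
  then have "psd ?N"
    unfolding psd_def using dagger_eq_self_if_quadratic_form_real by blast
  then show ?thesis
    using U max that by blast
qed

text \<open>For the maximizing \<open>U\<close>, the matrix \<open>U ** A\<close> is positive
  semidefinite with square \<open>dagger A ** A\<close>. Hence the maximum is the trace norm
  itself.\<close>

lemma Re_trace_unitary_mult_le_trace_norm:
  assumes "unitary V"
  shows "Re (trace (V ** A)) \<le> trace_norm A"
proof -
  obtain U where U: "unitary U" "psd (U ** A)"
    "\<And>V. unitary V \<Longrightarrow> Re (trace (V ** A)) \<le> Re (trace (U ** A))"
    by (rule polar_decomposition[of A]) (blast intro: that)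
  have "(U ** A) ** (U ** A) = dagger (U ** A) ** (U ** A)"
    using U(2) by (simp add: psd_def)
  also have "\<dots> = dagger A ** (dagger U ** U) ** A"
    by (simp add: dagger_mult matrix_mul_assoc)
  finally have "trace_norm A = Re (trace (U ** A))"
    using U(1,2) by (intro trace_norm_eqI) (simp_all add: unitary_def)
  then show ?thesis
    using U(3)[OF assms] by simp
qed

text \<open>Testing against 1 and -1 bounds both the real part of the trace and its
  negative.\<close>

lemma trace_norm_nonneg: "0 \<le> trace_norm A"
proof -
  have "trace (- mat 1 ** A) = - trace A"
    by (simp add: trace_uminus_mult)
  then show ?thesis
    using Re_trace_unitary_mult_le_trace_norm[OF unitary_mat_1, of A]
      Re_trace_unitary_mult_le_trace_norm[OF unitary_uminus[OF unitary_mat_1], of A]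
    by simp
qed

section \<open>Trace distance and fidelity of pure states\<close>

text \<open>The unitary tested here is the reflection \<open>2 |u\<rangle>\<langle>u| - 1\<close>.\<close>

lemma one_minus_overlap_le_trace_distance:
  assumes u: "norm u = 1" and s: "trace \<sigma> = 1"
  shows "1 - Re (braket u (\<sigma> *v u)) \<le> trace_distance (ket_bra u) \<sigma>"
proof -
  let ?A = "ket_bra u - \<sigma>"
  \<comment> \<open>Minus the reflection, written as the phase change with \<open>e = -1\<close>;
    the sign is restored below by passing to \<open>- ?R\<close>.\<close>
  let ?R = "mat 1 + outer ((-1 - 1) *s u) u"
  have "trace (?R ** ?A) = trace ?A - 2 * braket u (?A *v u)"
    unfolding trace_phase_mult by simp
  moreover have "trace ?A = 0"
    using ket_bra_density[OF u] s
    by (simp add: density_operators_def trace_sub)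
  moreover have "braket u (ket_bra u *v u) = 1"
    using u by (simp add: ket_bra_eq_outer outer_mult_vector braket_self)
  moreover have "trace (- ?R ** ?A) = - trace (?R ** ?A)"
    by (rule trace_uminus_mult)
  ultimately have "trace (- ?R ** ?A) = 2 * (1 - braket u (\<sigma> *v u))"
    by (simp add: matrix_vector_mult_diff_rdistrib braket_diff_right)
  moreover have "Re (trace (- ?R ** ?A)) \<le> trace_norm ?A"
    using u by (intro Re_trace_unitary_mult_le_trace_norm unitary_uminus unitary_phase) auto
  ultimately show ?thesis
    by (simp add: trace_distance_def)
qed

text \<open>Here \<open>A\<^sup>3 = s\<^sup>2 A\<close> for \<open>A = |u\<rangle>\<langle>u| - |v\<rangle>\<langle>v|\<close> and \<open>s\<^sup>2 = 1 - |\<langle>u|v\<rangle>|\<^sup>2\<close>, whence \<open>|A| = A\<^sup>2 / s\<close>.\<close>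

lemma trace_distance_ket_bra:
  assumes u: "norm u = 1" and v: "norm v = 1"
  shows "trace_distance (ket_bra u) (ket_bra v) = sqrt (1 - (cmod (braket u v))\<^sup>2)"
proof -
  define F G where "F = ket_bra u" and "G = ket_bra v"
  define A where "A = F - G"
  define c where "c = (cmod (braket u v))\<^sup>2"
  define s where "s = sqrt (1 - c)"
  have hA: "dagger A = A"
    by (simp add: A_def F_def G_def dagger_diff ket_bra_eq_outer dagger_outer)
  have FF: "F ** F = F" and GG: "G ** G = G"
    using u v by (simp_all add: F_def G_def ket_bra_eq_outer outer_mult braket_self)
  have cc: "braket u v * braket v u = of_real c" "braket v u * braket u v = of_real c"
    unfolding c_def complex_norm_square by (simp_all add: cnj_braket mult.commute)
  have FGF: "F ** G ** F = c *\<^sub>R F" and GFG: "G ** F ** G = c *\<^sub>R G"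
    unfolding F_def G_def ket_bra_eq_outer outer_mult
    by (simp_all add: braket_smult_left braket_smult_right vector_smult_assoc cc)
      (simp_all add: outer_def vec_eq_iff scaleR_conv_of_real[where 'a = complex])
  have trF: "trace F = 1" "trace G = 1"
    using ket_bra_density u v by (auto simp: F_def G_def density_operators_def)
  have trFG: "trace (F ** G) = of_real c" "trace (G ** F) = of_real c"
    by (simp_all add: F_def G_def ket_bra_eq_outer trace_outer_mult outer_mult_vector
        braket_smult_right cc)
  have trA2: "trace (A ** A) = 2 * of_real (1 - c)"
    by (simp add: A_def matrix_diff_ldistrib matrix_diff_rdistrib trace_sub FF GG trF trFG)
  then have normA: "(norm A)\<^sup>2 = 2 * (1 - c)"
    using trace_dagger_mult_self[of A] unfolding hA
    by (metis of_real_eq_iff of_real_mult of_real_numeral)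
  \<comment> \<open>The Cauchy-Schwarz bound on the overlap, read off from the nonnegative squared
    norm of \<open>A\<close>.\<close>
  then have "c \<le> 1"
    by (smt (verit) zero_le_power2)
  then have s2: "s * s = 1 - c"
    by (simp add: s_def)
  have GFF: "G ** F ** F = G ** F" and FGG: "F ** G ** G = F ** G"
    by (simp_all add: FF GG flip: matrix_mul_assoc)
  have A2: "A ** A = F - F ** G - G ** F + G"
    by (simp add: A_def matrix_diff_ldistrib matrix_diff_rdistrib FF GG)
  have "A ** A ** A = (1 - c) *\<^sub>R A"
    unfolding A2 unfolding A_def
    by (simp add: matrix_diff_ldistrib matrix_diff_rdistrib matrix_add_rdistrib FF GG FGF GFG
        GFF FGG scaleR_diff_left scaleR_diff_right)
  then have A4: "A ** A ** (A ** A) = (1 - c) *\<^sub>R (A ** A)"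
    by (simp add: matrix_mul_assoc flip: scalar_matrix_assoc)
  define B where "B = (1 / s) *\<^sub>R (A ** A)"
  have "psd B"
    unfolding B_def using psd_dagger_mult_self[of A] \<open>c \<le> 1\<close>
    by (intro psd_scaleR) (auto simp: hA s_def)
  moreover have "B ** B = dagger A ** A"
  proof (cases "s = 0")
    \<comment> \<open>Division by zero makes \<open>B = 0\<close> here, which is the right root:
      \<open>s = 0\<close> forces \<open>A = 0\<close> through \<open>normA\<close>.\<close>
    case True
    then have "A = 0"
      using normA s2 by auto
    then show ?thesis
      by (simp add: B_def matrix_matrix_mult_def vec_eq_iff)
  next
    case False
    then show ?thesis
      using A4 by (simp add: B_def hA matrix_scalar_ac flip: scalar_matrix_assoc s2)
  qed
  ultimately have "trace_norm A = Re (trace B)"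
    by (rule trace_norm_eqI)
  also have "\<dots> = 2 * s"
    using s2 by (cases "s = 0") (simp_all add: B_def trace_scaleR trA2
        trace_0[simplified] field_simps)
  finally show ?thesis
    by (simp add: trace_distance_def A_def F_def G_def s_def c_def)
qed

lemma norm_ket_bra:
  assumes "norm u = 1"
  shows "norm (ket_bra u) = 1"
proof -
  have "complex_of_real ((norm (ket_bra u))\<^sup>2) = 1"
    using trace_dagger_mult_self[of "ket_bra u"] ket_bra_density[OF assms] assms
    by (simp add: ket_bra_eq_outer dagger_outer outer_mult braket_self density_operators_def)
  then show ?thesis
    by (metis norm_ge_zero of_real_eq_1_iff power2_eq_1_iff abs_of_nonneg abs_neg_one abs_1)
qed

text \<open>Strict convexity of the Euclidean ball: a point inside an open segment is strictly
  closer to the origin than one of the endpoints.\<close>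

lemma extreme_point_of_if_on_unit_sphere:
  fixes S :: "'a::euclidean_space set"
  assumes "S \<subseteq> cball 0 1" "x \<in> S" "norm x = 1"
  shows "x extreme_point_of S"
  unfolding extreme_point_of_def
proof (intro conjI ballI notI)
  fix a b
  assume "a \<in> S" "b \<in> S" "x \<in> open_segment a b"
  then have "dist 0 x < dist 0 a \<or> dist 0 x < dist 0 b" "norm a \<le> 1" "norm b \<le> 1"
    using assms(1) dist_decreases_open_segment[of x a b 0] by auto
  then show False
    using assms(3) by auto
qed (use assms in auto)

section \<open>The inverse binary entropy\<close>

text \<open>Only the point 0 is delicate: the product is 0 there, which is also its limit from the
  right.\<close>

lemma continuous_on_mult_ln: "continuous_on {0..} (\<lambda>x::real. x * ln x)"
  unfolding continuous_on_eq_continuous_within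
proof
  fix x :: real
  assume "x \<in> {0..}"
  show "continuous (at x within {0..}) (\<lambda>x. x * ln x)"
  proof (cases "x = 0")
    case True
    have "((\<lambda>x::real. x * ln x) \<longlongrightarrow> 0) (at_right 0)"
      by real_asymp
    then show ?thesis
      unfolding True continuous_within at_within_Ici_at_right by simp
  next
    case False
    then show ?thesis
      by (intro continuous_intros) auto
  qed
qed

lemma binary_entropy_eq_ln:
  "binary_entropy = (\<lambda>x. (- (x * ln x) - (1 - x) * ln (1 - x)) / ln 2)"
  by (auto simp: binary_entropy_def log_def field_simps)

lemma continuous_on_binary_entropy: "continuous_on {0..1} binary_entropy"
proof -
  have "continuous_on {0..1::real} (\<lambda>x. (1 - x) * ln (1 - x))"
    by (rule continuous_on_compose2[OF continuous_on_mult_ln]) (auto intro!: continuous_intros)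
  moreover have "continuous_on {0..1::real} (\<lambda>x. x * ln x)"
    by (rule continuous_on_subset[OF continuous_on_mult_ln]) auto
  ultimately show ?thesis
    unfolding binary_entropy_eq_ln
    by (intro continuous_on_divide continuous_on_diff continuous_on_minus continuous_on_const) auto
qed

text \<open>The derivative is log((1 - t)/t), negative for t > 1/2. It is used only in the open
  interval; continuity handles the endpoint 1.\<close>

lemma binary_entropy_strict_antimono:
  assumes "1/2 \<le> x" "x < y" "y \<le> 1"
  shows "binary_entropy y < binary_entropy x"
proof (rule DERIV_neg_imp_decreasing_open[OF assms(2)])
  fix t
  assume t: "x < t" "t < y"
  have "((\<lambda>x. x * ln x) has_real_derivative (ln t + 1)) (at t)"
    using t assms by (auto intro!: derivative_eq_intros)
  moreover have "((\<lambda>x. (1 - x) * ln (1 - x)) has_real_derivative (- ln (1 - t) - 1)) (at t)"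
    using t assms by (auto intro!: derivative_eq_intros)
  ultimately have "(binary_entropy has_real_derivative
      (- (ln t + 1) - (- ln (1 - t) - 1)) / ln 2) (at t)"
    unfolding binary_entropy_eq_ln by (intro DERIV_cdivide DERIV_diff DERIV_minus)
  moreover have "(- (ln t + 1) - (- ln (1 - t) - 1)) / ln 2 < 0"
    using t assms by (auto simp: divide_less_0_iff)
  ultimately show "\<exists>d. (binary_entropy has_real_derivative d) (at t) \<and> d < 0"
    by blast
next
  show "continuous_on {x..y} binary_entropy"
    using continuous_on_binary_entropy by (rule continuous_on_subset) (use assms in auto)
qed

lemma binary_entropy_1_minus: "binary_entropy (1 - x) = binary_entropy x"
  by (simp add: binary_entropy_def algebra_simps)

lemma binary_entropy_nonneg:
  assumes "0 \<le> x" "x \<le> 1"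
  shows "0 \<le> binary_entropy x"
proof -
  have "x * log 2 x \<le> 0" if "0 \<le> x" "x \<le> 1" for x :: real
    using that by (cases "x = 0") (auto simp: mult_nonneg_nonpos)
  from this[of x] this[of "1 - x"] show ?thesis
    using assms by (simp add: binary_entropy_def)
qed

text \<open>By symmetry \<open>binary_entropy (1 - x) \<le> y\<close>. Both \<open>1 - x\<close> and
  the preimage of \<open>y\<close> lie in [1/2, 1], where the entropy decreases, so the preimage is
  at most \<open>1 - x\<close>.\<close>

lemma binary_entropy_inv_le:
  assumes "0 \<le> x" "x \<le> 1/2" "binary_entropy x \<le> y" "y \<le> 1"
  shows "binary_entropy_inv y \<le> 1 - x"
proof -
  have inj: "inj_on binary_entropy {1/2..1}"
    by (rule linorder_inj_onI') (use binary_entropy_strict_antimono in force)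
  have "0 \<le> y"
    using binary_entropy_nonneg[of x] assms by linarith
  \<comment> \<open>The entropy runs from 1 at 1/2 down to 0 at 1, so it attains \<open>y\<close> in
    between.\<close>
  then have "\<exists>z\<ge>1/2. z \<le> 1 \<and> binary_entropy z = y"
    using assms(4) continuous_on_subset[OF continuous_on_binary_entropy]
    by (intro IVT2') (auto simp: binary_entropy_def log_def ln_div)
  then obtain z where z: "1/2 \<le> z" "z \<le> 1" "binary_entropy z = y"
    by blast
  have "binary_entropy_inv y = z"
    unfolding binary_entropy_inv_def using z by (intro the_inv_into_f_eq[OF inj]) auto
  moreover have "z \<le> 1 - x"
    using binary_entropy_strict_antimono[of "1 - x" z] assms z
    by (force simp: binary_entropy_1_minus)
  ultimately show ?thesis
    by simp
qed

text \<open>For \<open>D \<ge> 2\<close> the logarithmic term is nonnegative, which gives the lower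
  bound. The upper bound is continuity at 0, where the Fannes error vanishes.\<close>

lemma fannes_small:
  assumes "D \<ge> 2"
  obtains \<delta> where "0 < \<delta>" "\<delta> \<le> 1/2"
    "\<And>t. 0 \<le> t \<Longrightarrow> t \<le> \<delta> \<Longrightarrow> binary_entropy t \<le> fannes t D \<and> fannes t D \<le> 1"
proof -
  have "continuous_on {0..1} (\<lambda>t. fannes t D)"
    unfolding fannes_def by (intro continuous_intros continuous_on_binary_entropy)
  then obtain d where d: "d > 0"
    "\<And>t. t \<in> {0..1} \<Longrightarrow> dist t 0 < d \<Longrightarrow> dist (fannes t D) (fannes 0 D) < 1"
    unfolding continuous_on_iff by (metis atLeastAtMost_iff order_refl zero_le_one zero_less_one)
  show ?thesis
  \<comment> \<open>Halving \<open>d\<close> turns the closed bound on \<open>t\<close> into the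
    strict one required by continuity; the cap 1/2 is what \<open>binary_entropy_inv_le\<close> asks
    for.\<close>
  proof (rule that[of "min (d / 2) (1/2)"])
    fix t
    assume t: "0 \<le> t" "t \<le> min (d / 2) (1/2)"
    have "0 \<le> t * log 2 (real D - 1)"
      using t assms by (intro mult_nonneg_nonneg) auto
    moreover have "fannes 0 D = 0"
      by (simp add: fannes_def binary_entropy_def)
    ultimately show "binary_entropy t \<le> fannes t D \<and> fannes t D \<le> 1"
      using d(2)[of t] d(1) t by (auto simp: fannes_def dist_real_def)
  qed (use d in auto)
qed

section \<open>Vertices close to a pure state\<close>

text \<open>The vertex \<open>k\<close> of largest overlap is chosen before any state of the
  polytope. It therefore serves all of them at once, and the bound passes to the infimum.\<close>

lemma exists_vertex_overlap:
  fixes \<psi> :: "nat \<Rightarrow> complex ^ 'i"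
  assumes "finite J" "J \<noteq> {}" "\<And>j. j \<in> J \<Longrightarrow> norm (\<psi> j) = 1" "norm \<phi> = 1"
  shows "\<exists>j\<in>J. 1 - (cmod (braket \<phi> (\<psi> j)))\<^sup>2
    \<le> distance_to (convex hull ((\<lambda>j. ket_bra (\<psi> j)) ` J)) (ket_bra \<phi>)"
proof -
  let ?P = "convex hull ((\<lambda>j. ket_bra (\<psi> j)) ` J)"
  let ?c = "\<lambda>j. (cmod (braket \<phi> (\<psi> j)))\<^sup>2"
  have "Max (?c ` J) \<in> ?c ` J"
    using assms(1,2) by (intro Max_in) auto
  then obtain k where "k \<in> J" "Max (?c ` J) = ?c k"
    by blast
  then have k: "k \<in> J" "\<And>j. j \<in> J \<Longrightarrow> ?c j \<le> ?c k"
    using assms(1) by (metis Max_ge finite_imageI imageI)+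
  have "?P \<subseteq> {\<sigma>. Re (braket \<phi> (\<sigma> *v \<phi>)) \<le> ?c k}"
  proof (rule hull_minimal)
    have "braket \<phi> (ket_bra (\<psi> j) *v \<phi>) = of_real (?c j)" for j
      unfolding complex_norm_square
      by (simp add: ket_bra_eq_outer outer_mult_vector braket_smult_right cnj_braket)
    then show "(\<lambda>j. ket_bra (\<psi> j)) ` J \<subseteq> {\<sigma>. Re (braket \<phi> (\<sigma> *v \<phi>)) \<le> ?c k}"
      using k by auto
    have "linear (\<lambda>\<sigma>. Re (braket \<phi> (\<sigma> *v \<phi>)))"
      by (rule linearI) (simp_all add: braket_def matrix_vector_mult_def algebra_simps
          sum.distrib scaleR_sum_right sum_distrib_left)
    from convex_linear_vimage[OF this convex_real_interval(2)[of "?c k"]]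
    show "convex {\<sigma>. Re (braket \<phi> (\<sigma> *v \<phi>)) \<le> ?c k}"
      by (simp add: vimage_def)
  qed
  moreover have "?P \<subseteq> density_operators"
    using convex_hull_ket_bra_subset[of "\<psi> ` J"] assms(3) by (auto simp: image_image)
  ultimately have "1 - ?c k \<le> trace_distance (ket_bra \<phi>) \<sigma>" if "\<sigma> \<in> ?P" for \<sigma>
    using that one_minus_overlap_le_trace_distance[OF assms(4), of \<sigma>]
    by (force simp: density_operators_def)
  then have "1 - ?c k \<le> distance_to ?P (ket_bra \<phi>)"
    unfolding distance_to_def using assms(2) by (intro cINF_greatest) auto
  then show ?thesis
    using k(1) by blast
qed

theorem theoremV2:
  fixes \<psi> :: "nat \<Rightarrow> ('d::finite, 'n::finite) hspace"
    and P :: "('d, 'n) hop set"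
    and m :: nat
  assumes "prime CARD('d)"
    and "m \<ge> 1"
    and "\<And>j. j \<in> {1..m} \<Longrightarrow> norm (\<psi> j) = 1"
    and "P = convex hull ((\<lambda>j. ket_bra (\<psi> j)) ` {1..m})"
  shows "\<exists>\<epsilon>s>0. \<forall>(\<phi> :: ('d, 'n) hspace) \<epsilon>.
           norm \<phi> = 1 \<and> distance_to P (ket_bra \<phi>) = \<epsilon> \<and> \<epsilon> \<le> \<epsilon>s \<longrightarrow>
             fannes \<epsilon> (CARD('d) ^ CARD('n)) \<in> {0..1} \<and>
             (\<exists>j\<in>{1..m}. ket_bra (\<psi> j) extreme_point_of P \<and>
                trace_distance (ket_bra \<phi>) (ket_bra (\<psi> j))
                  \<le> \<epsilon> + 2 * sqrt (1 - binary_entropy_inv (fannes \<epsilon> (CARD('d) ^ CARD('n)))))"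
proof -
  let ?D = "CARD('d) ^ CARD('n)"
  have "2 ^ 1 \<le> ?D"
    using prime_ge_2_nat[OF assms(1)]
    by (intro order_trans[OF power_mono power_increasing]) (auto simp: Suc_le_eq)
  then have "?D \<ge> 2"
    by simp
  then obtain \<delta> where \<delta>: "0 < \<delta>" "\<delta> \<le> 1/2"
    "\<And>t. 0 \<le> t \<Longrightarrow> t \<le> \<delta> \<Longrightarrow> binary_entropy t \<le> fannes t ?D \<and> fannes t ?D \<le> 1"
    by (rule fannes_small) (blast intro: that)
  have unit: "norm (ket_bra (\<psi> j)) = 1" if "j \<in> {1..m}" for j
    by (rule norm_ket_bra) (rule assms(3)[OF that])
  have ball: "P \<subseteq> cball 0 1"
    unfolding assms(4) using unit by (intro hull_minimal image_subsetI convex_cball) simp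
  show ?thesis
  proof (intro exI[of _ \<delta>] conjI allI impI \<delta>(1))
    fix \<phi> :: "('d, 'n) hspace" and \<epsilon>
    assume *: "norm \<phi> = 1 \<and> distance_to P (ket_bra \<phi>) = \<epsilon> \<and> \<epsilon> \<le> \<delta>"
    obtain j where j: "j \<in> {1..m}" "1 - (cmod (braket \<phi> (\<psi> j)))\<^sup>2 \<le> \<epsilon>"
      using exists_vertex_overlap[of "{1..m}" \<psi> \<phi>] assms * by auto
    have T: "trace_distance (ket_bra \<phi>) (ket_bra (\<psi> j)) \<le> sqrt \<epsilon>"
      using trace_distance_ket_bra[of \<phi> "\<psi> j"] assms(3)[OF j(1)] * j by simp
    have "0 \<le> distance_to P (ket_bra \<phi>)"
      unfolding distance_to_def trace_distance_def using assms(2,4) trace_norm_nonneg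
      by (intro cINF_greatest) auto
    then have "0 \<le> \<epsilon>"
      using * by simp
    then have f: "binary_entropy \<epsilon> \<le> fannes \<epsilon> ?D" "fannes \<epsilon> ?D \<le> 1" "0 \<le> binary_entropy \<epsilon>"
      using \<delta> * binary_entropy_nonneg[of \<epsilon>] by auto
    then show "fannes \<epsilon> ?D \<in> {0..1}"
      by auto
    have "\<epsilon> \<le> 1 - binary_entropy_inv (fannes \<epsilon> ?D)"
      using binary_entropy_inv_le[of \<epsilon> "fannes \<epsilon> ?D"] \<open>0 \<le> \<epsilon>\<close> f \<delta> * by auto
    \<comment> \<open>A single copy of the root already dominates \<open>sqrt \<epsilon>\<close>;
      the other copy and the summand \<open>\<epsilon>\<close> are nonnegative.\<close>
    then have "sqrt \<epsilon> \<le> \<epsilon> + 2 * sqrt (1 - binary_entropy_inv (fannes \<epsilon> ?D))"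
      using \<open>0 \<le> \<epsilon>\<close> real_sqrt_le_mono[of \<epsilon> "1 - binary_entropy_inv (fannes \<epsilon> ?D)"]
        real_sqrt_ge_zero[of \<epsilon>] by linarith
    moreover have "ket_bra (\<psi> j) extreme_point_of P"
      unfolding assms(4) using ball[unfolded assms(4)] unit[OF j(1)] j(1)
      by (intro extreme_point_of_if_on_unit_sphere hull_inc imageI)
    ultimately show "\<exists>j\<in>{1..m}. ket_bra (\<psi> j) extreme_point_of P \<and>
                trace_distance (ket_bra \<phi>) (ket_bra (\<psi> j))
                  \<le> \<epsilon> + 2 * sqrt (1 - binary_entropy_inv (fannes \<epsilon> ?D))"
      using T j(1) by (meson order_trans)
  qed
qed

end
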